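(* Let $F$ be the sequential cellular automaton of radius $\frac{1}{2}$ over the alphabet $\Sigma=\mathbb{B}\cup T$ described in the context. For every integer $n\ge 1$ and every $x\in\mathbb{B}^n$ with $|x|_0\neq|x|_1$, let $b\in\mathbb{B}$ be the symbol with $|x|_b>|x|_{1-b}$. Then there exists $K\in\mathbb{N}$ such that $F^k(x)=b^n$ for all $k\ge K$, and $b^n$ is a fixed point of $F$, i.e. $F(b^n)=b^n$. (That is, $F$ solves the density classification task using an intermediate alphabet.) This holds for any choice of the unspecified values in rule (R5).
   Context: Let $\mathbb{B}=\{0,1\}$. For $x\in\mathbb{B}^n$ and $b\in\mathbb{B}$, $|x|_b$ is the number of positions of $x$ equal to $b$. An intermediate symbol is a triple $(c,v,M)$ with counter $c\in\{\circ,\bullet\}$, value $v\in\{0,1,X\}$ and memory $M\subseteq\mathbb{B}$, subject to: if $v\in\mathbb{B}$ then $v\in M$ (this gives 16 triples); $T$ is the set of these triples and $\Sigma=\mathbb{B}\cup T$. For a counter $c$, $\bar c$ denotes the other counter symbol. The local rule $f:\Sigma\times\Sigma\to\Sigma$, $f(a,y)$ with $a$ the left neighbour and $y$ the cell being updated, is: (R1) $f(b,b)=b$ for $b\in\mathbb{B}$; (R2) $f(b,b')=(\circ,X,\{b'\})$ for $b\neq b'$ in $\mathbb{B}$; (R3) for $b\in\mathbb{B}$: $f((c,v,M),b)=(c,X,M\cup\{b\})$ if $b\notin M$, and $f((c,v,M),b)=(c,b,M)$ if $b\in M$; (R4) for $c'\neq c$: $f((c,v,M),(c',w,M'))=(c,X,M\cup\{w\})$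 if $w\in\mathbb{B}\setminus M$, and $=(c,w,M)$ if $w\in M\cup\{X\}$; (R5) $f((c,v,M),(c,w,M'))=(\bar c,X,\emptyset)$ if $M=\mathbb{B}$; $=b$ if $M=\{b\}$; an arbitrary fixed element of $\Sigma$ if $M=\emptyset$; (R6) $f(b,(c,v,M))=b$ for $b\in\mathbb{B}$. Configurations $z\in\Sigma^n$ are cyclic, with cells $1,\dots,n$, the left neighbour of cell $1$ being cell $n$. One application of $F$ (sequential update) performs, for $i=1,2,\dots,n$ in this order, the assignment $z_i:=f(z_{i-1},z_i)$ (with $z_0:=z_n$), each step using the current values (so for $i\ge2$ the already updated $z_{i-1}$ is used, and for $i=1$ the value of $z_n$ left by the previous application). $F^k$ denotes $k$ applications of $F$. *)

theory Defs
  imports Main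
begin

text \<open>The binary alphabet is \<^typ>\<open>bool\<close>, with \<^term>\<open>False\<close> for 0 and \<^term>\<open>True\<close> for 1.\<close>

datatype counter = Circ | Bullet

datatype cell_value = Bin bool | ValX

datatype symbol = Bit bool | Inter counter cell_value "bool set"

text \<open>The type \<^typ>\<open>symbol\<close> also contains triples violating the side condition on value and memory;
  the alphabet proper is the set \<open>Sigma_alph\<close>.\<close>

definition T_alph :: "symbol set" where
  "T_alph = {Inter c v M | c v M. \<forall>b. v = Bin b \<longrightarrow> b \<in> M}"

definition Sigma_alph :: "symbol set" where
  "Sigma_alph = range Bit \<union> T_alph"

fun other :: "counter \<Rightarrow> counter" where
  "other Circ = Bullet"
| "other Bullet = Circ"

text \<open>The argument \<open>d\<close> supplies the values left open when the counters agree and the left memory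
  is empty; they may depend on both neighbouring symbols.\<close>

fun local_rule :: "(symbol \<Rightarrow> symbol \<Rightarrow> symbol) \<Rightarrow> symbol \<Rightarrow> symbol \<Rightarrow> symbol" where
  "local_rule d (Bit b) (Bit b') = (if b = b' then Bit b else Inter Circ ValX {b'})"
| "local_rule d (Inter c v M) (Bit b) =
     (if b \<notin> M then Inter c ValX (M \<union> {b}) else Inter c (Bin b) M)"
| "local_rule d (Inter c v M) (Inter c' w M') =
     (if c' \<noteq> c then
        (case w of
           ValX \<Rightarrow> Inter c ValX M
         | Bin b \<Rightarrow> if b \<notin> M then Inter c ValX (M \<union> {b}) else Inter c (Bin b) M)
      else if M = UNIV then Inter (other c) ValX {}
      else if M = {} then d (Inter c v M) (Inter c' w M')
      else Bit (the_elem M))"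
| "local_rule d (Bit b) (Inter c v M) = Bit b"

text \<open>Cells are indexed from 0; the left neighbour of cell 0 is the last cell.\<close>

definition update_cell :: "(symbol \<Rightarrow> symbol \<Rightarrow> symbol) \<Rightarrow> nat \<Rightarrow> symbol list \<Rightarrow> symbol list" where
  "update_cell d i z =
     z[i := local_rule d (z ! (if i = 0 then length z - 1 else i - 1)) (z ! i)]"

definition seq_update :: "(symbol \<Rightarrow> symbol \<Rightarrow> symbol) \<Rightarrow> symbol list \<Rightarrow> symbol list" where
  "seq_update d z = fold (update_cell d) [0..<length z] z"

lemma card_T_alph: "card T_alph = 16"
proof -
  let ?S = "{(ValX, {}), (ValX, {False}), (ValX, {True}), (ValX, {False, True}),
    (Bin False, {False}), (Bin False, {False, True}),
    (Bin True, {True}), (Bin True, {False, True})}"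
  let ?f = "\<lambda>(c, v, M). Inter c v M"
  have M: "M = {} \<or> M = {False} \<or> M = {True} \<or> M = {False, True}" for M :: "bool set"
  proof -
    have "M \<in> Pow {False, True}" by (simp add: UNIV_bool [symmetric])
    then show ?thesis by (simp add: Pow_insert) blast
  qed
  have S: "{(v, M). \<forall>b. v = Bin b \<longrightarrow> b \<in> M} = ?S" (is "?P = _")
  proof (intro set_eqI, clarify)
    fix v and M :: "bool set"
    show "(v, M) \<in> ?P \<longleftrightarrow> (v, M) \<in> ?S"
    proof (cases v)
      case (Bin b)
      then show ?thesis using M[of M] by (cases b) auto
    next
      case ValX
      then show ?thesis using M[of M] by simp
    qed
  qed
  have C: "UNIV = {Circ, Bullet}" using counter.exhaust by blast
  have "T_alph = ?f ` (UNIV \<times> ?P)"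
    unfolding T_alph_def by (auto simp: image_iff)
  moreover have "inj_on ?f (UNIV \<times> ?P)"
    by (rule inj_onI) (simp add: case_prod_beta prod_eq_iff)
  ultimately have "card T_alph = card ((UNIV :: counter set) \<times> ?P)"
    using card_image[of ?f "UNIV \<times> ?P"] by presburger
  also have "\<dots> = card (UNIV :: counter set) * card ?S"
    by (simp only: card_cartesian_product S)
  also have "card ?S = 8" by simp
  also have "card (UNIV :: counter set) = 2" by (simp add: C)
  finally show ?thesis by simp
qed

lemma Bit_in_Sigma [simp]: "Bit b \<in> Sigma_alph"
  by (simp add: Sigma_alph_def)

lemma Inter_in_Sigma [simp]:
  "Inter c v M \<in> Sigma_alph \<longleftrightarrow> (\<forall>b. v = Bin b \<longrightarrow> b \<in> M)"
  by (auto simp: Sigma_alph_def T_alph_def)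

lemma local_rule_closed:
  assumes "\<And>a y. a \<in> Sigma_alph \<Longrightarrow> y \<in> Sigma_alph \<Longrightarrow> d a y \<in> Sigma_alph"
    and "a \<in> Sigma_alph" "y \<in> Sigma_alph"
  shows "local_rule d a y \<in> Sigma_alph"
proof (cases a)
  case a: (Bit b)
  show ?thesis by (cases y) (simp_all add: a)
next
  case a: (Inter c v M)
  show ?thesis
  proof (cases y)
    case (Bit b)
    then show ?thesis by (simp add: a)
  next
    case y: (Inter c' w M')
    have "d (Inter c v M) (Inter c' w M') \<in> Sigma_alph"
      using assms unfolding a y by blast
    then show ?thesis by (cases w; cases "M = {}"; cases "c' = c") (simp_all add: a y)
  qed
qed

end

theory Submission
  imports Defs
begin

text \<open>The update proceeds cyclically through the cells, so a configuration can be read as a queue: the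
  head is the cell to be updated next and the last entry is its left neighbour. The first cell
  that differs from its left neighbour becomes the starting point of rounds of length \<open>n\<close>. During a
  round the counter is constant, and the memory collects the symbols seen so far; the first 0 and
  the first 1 met are erased. When a round returns to the starting point with memory
  \<open>{0, 1}\<close>, one 0 and one 1 have been cancelled, so the majority is preserved and a new round with
  the other counter begins. Otherwise only the majority symbol was left, and it spreads over all
  cells. The memory is never empty at the end of a round, so the unspecified values are irrelevant.\<close>

definition queue_step :: "(symbol \<Rightarrow> symbol \<Rightarrow> symbol) \<Rightarrow> symbol list \<Rightarrow> symbol list" where
  "queue_step d q = tl q @ [local_rule d (last q) (hd q)]"

fun scan :: "(symbol \<Rightarrow> symbol \<Rightarrow> symbol) \<Rightarrow> symbol \<Rightarrow> symbol list \<Rightarrow> symbol list" where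
  "scan d a [] = []"
| "scan d a (y # ys) = local_rule d a y # scan d (local_rule d a y) ys"

definition reaches :: "(symbol \<Rightarrow> symbol \<Rightarrow> symbol) \<Rightarrow> symbol list \<Rightarrow> symbol list \<Rightarrow> bool" where
  "reaches d q q' \<longleftrightarrow> (\<exists>m. (queue_step d ^^ m) q = q')"

fun val :: "symbol \<Rightarrow> cell_value" where
  "val (Bit b) = Bin b"
| "val (Inter c v M) = v"

text \<open>Cells not yet visited by the current round, whose counter is \<open>c\<close>.\<close>

definition fresh :: "counter \<Rightarrow> symbol \<Rightarrow> bool" where
  "fresh c s \<longleftrightarrow> (\<forall>c' v M. s = Inter c' v M \<longrightarrow> c' \<noteq> c)"

text \<open>Bits and intermediate symbols carrying a value count alike, so one measure serves before
  and during the rounds; a cell with \<open>ValX\<close> counts as erased.\<close>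

definition cnt :: "bool \<Rightarrow> symbol list \<Rightarrow> nat" where
  "cnt b ss = count_list (map val ss) (Bin b)"

lemma cnt_simps [simp]:
  "cnt b [] = 0"
  "cnt b (s # ss) = (if val s = Bin b then 1 else 0) + cnt b ss"
  by (simp_all add: cnt_def)

lemma cnt_map_Bit: "cnt b (map Bit x) = count_list x b"
  by (induction x) auto

lemma length_scan [simp]: "length (scan d a ys) = length ys"
  by (induction ys arbitrary: a) auto

text \<open>Rotating the array by \<open>i\<close> puts the next cell to be updated at the head and
  its cyclic left neighbour at the end; each update advances the rotation by one.\<close>

lemma update_prefix:
  assumes "i \<le> length z"
  shows "length (fold (update_cell d) [0..<i] z) = length z \<and>
    (queue_step d ^^ i) z =
      drop i (fold (update_cell d) [0..<i] z) @ take i (fold (update_cell d) [0..<i] z)"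
  using assms
proof (induction i)
  case (Suc i)
  define w where "w = fold (update_cell d) [0..<i] z"
  have len: "length w = length z" and st: "(queue_step d ^^ i) z = drop i w @ take i w"
    using Suc by (auto simp: w_def)
  have i: "i < length w" using Suc.prems len by simp
  define a where "a = local_rule d (w ! (if i = 0 then length w - 1 else i - 1)) (w ! i)"
  have upd: "fold (update_cell d) [0..<Suc i] z = w[i := a]"
    by (simp add: w_def [symmetric] update_cell_def a_def)
  \<comment> \<open>For \<open>i = 0\<close> the second part is empty, which yields the wrap-around
    to the last cell.\<close>
  have "last (drop i w @ take i w) = w ! (if i = 0 then length w - 1 else i - 1)"
    using i by (cases "i = 0") (auto simp: last_conv_nth last_append min_def)
  then have "queue_step d (drop i w @ take i w) = drop (Suc i) w @ take i w @ [a]"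
    using i by (auto simp: queue_step_def a_def hd_drop_conv_nth hd_append drop_Suc tl_drop)
  moreover have "take (Suc i) (w[i := a]) = take i w @ [a]"
    using i by (simp add: take_Suc_conv_app_nth)
  moreover have "drop (Suc i) (w[i := a]) = drop (Suc i) w" by simp
  ultimately have "(queue_step d ^^ Suc i) z = drop (Suc i) (w[i := a]) @ take (Suc i) (w[i := a])"
    using st by simp
  then show ?case using upd len by simp
qed simp

lemma seq_update_conv_queue: "seq_update d z = (queue_step d ^^ length z) z"
  using update_prefix[of "length z" z d] by (simp add: seq_update_def)

lemma length_seq_update [simp]: "length (seq_update d z) = length z"
  using update_prefix[of "length z" z d] by (simp add: seq_update_def)

lemma seq_update_funpow_conv_queue:
  "(seq_update d ^^ k) z = (queue_step d ^^ (k * length z)) z"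
proof (induction k)
  case (Suc k)
  have "length ((seq_update d ^^ k) z) = length z" by (induction k) auto
  then show ?case using Suc by (simp add: seq_update_conv_queue funpow_add)
qed simp

lemma queue_step_scan:
  assumes "p \<noteq> []"
  shows "(queue_step d ^^ length ys) (ys @ p) = p @ scan d (last p) ys"
  using assms
proof (induction ys arbitrary: p)
  case (Cons y ys)
  have "(queue_step d ^^ length (y # ys)) ((y # ys) @ p)
      = (queue_step d ^^ length ys) (ys @ p @ [local_rule d (last p) y])"
    using Cons.prems by (simp add: funpow_swap1 queue_step_def)
  also have "\<dots> = (p @ [local_rule d (last p) y]) @ scan d (local_rule d (last p) y) ys"
    using Cons.IH[of "p @ [local_rule d (last p) y]"] by simp
  finally show ?case by simp
qed simp

lemma reaches_trans: "reaches d p q \<Longrightarrow> reaches d q r \<Longrightarrow> reaches d p r"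
  unfolding reaches_def by (metis comp_apply funpow_add)

lemma reaches_step: "reaches d q (queue_step d q)"
  unfolding reaches_def by (rule exI[of _ 1]) simp

lemma reaches_scan: "p \<noteq> [] \<Longrightarrow> reaches d (ys @ p) (p @ scan d (last p) ys)"
  unfolding reaches_def using queue_step_scan by blast

lemma queue_step_funpow_replicate [simp]:
  assumes "n \<ge> 1"
  shows "(queue_step d ^^ m) (replicate n (Bit b)) = replicate n (Bit b)"
proof (induction m)
  case (Suc m)
  obtain k where "n = Suc k" using assms by (cases n) auto
  then show ?case using Suc by (simp add: queue_step_def replicate_append_same)
qed simp

lemma scan_Bit_replicate: "scan d (Bit b) (replicate i (Bit b)) = replicate i (Bit b)"
  by (induction i) auto

lemma scan_Bit_Inter:
  "\<forall>s\<in>set ss. \<exists>c v M. s = Inter c v M \<Longrightarrow> scan d (Bit b) ss = replicate (length ss) (Bit b)"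
  by (induction ss) auto

text \<open>Rules (R3) and (R4) agree on unvisited cells and depend only on their value, so a first
  round over bits and later rounds over intermediate symbols need no separate treatment.\<close>

lemma local_rule_fresh:
  assumes "fresh c s"
  shows "local_rule d (Inter c v M) s =
    (case val s of
       ValX \<Rightarrow> Inter c ValX M
     | Bin b \<Rightarrow> if b \<in> M then Inter c (Bin b) M else Inter c ValX (insert b M))"
  using assms by (cases s) (auto simp: fresh_def split: cell_value.split)

text \<open>Only the first occurrence of a symbol outside the current memory becomes
  \<open>ValX\<close>; the symbol then stays in the memory passed to the right, which protects its
  later occurrences.\<close>

lemma scan_round:
  assumes "\<forall>s\<in>set ss. fresh c s"
  shows "(\<forall>s\<in>set (scan d (Inter c v M) ss). \<exists>w N. s = Inter c w N) \<and>
    (\<exists>w. last (Inter c v M # scan d (Inter c v M) ss) = Inter c w (M \<union> {b. cnt b ss > 0})) \<and>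
    (\<forall>b. cnt b (scan d (Inter c v M) ss) + (if b \<notin> M \<and> cnt b ss > 0 then 1 else 0) = cnt b ss)"
  using assms
proof (induction ss arbitrary: v M)
  case (Cons s ss)
  have "\<exists>w N. local_rule d (Inter c v M) s = Inter c w N"
    using Cons.prems by (auto simp: local_rule_fresh split: cell_value.split)
  then obtain w N where step: "local_rule d (Inter c v M) s = Inter c w N" by blast
  have IH: "(\<forall>s\<in>set (scan d (Inter c w N) ss). \<exists>w N. s = Inter c w N) \<and>
    (\<exists>w'. last (Inter c w N # scan d (Inter c w N) ss) = Inter c w' (N \<union> {b. cnt b ss > 0})) \<and>
    (\<forall>b. cnt b (scan d (Inter c w N) ss) + (if b \<notin> N \<and> cnt b ss > 0 then 1 else 0) = cnt b ss)"
    using Cons by simp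
  have N: "N = M \<union> {b. val s = Bin b}"
    and w: "w = Bin b \<longleftrightarrow> val s = Bin b \<and> b \<in> M" for b
    using step Cons.prems
    by (auto simp: local_rule_fresh split: cell_value.splits if_splits)
  have mem: "N \<union> {b. cnt b ss > 0} = M \<union> {b. cnt b (s # ss) > 0}"
    unfolding N by auto
  have "cnt b (scan d (Inter c v M) (s # ss)) + (if b \<notin> M \<and> cnt b (s # ss) > 0 then 1 else 0)
      = cnt b (s # ss)" for b
    using IH[THEN conjunct2, THEN conjunct2, rule_format, of b]
    by (auto simp: step N w split: if_splits)
  then show ?case using IH by (simp add: step mem)
qed simp

text \<open>The starting cell of a round has value \<open>X\<close> and its memory \<open>M\<close> holds the symbols already erased
  in this round, so the surviving copies of \<open>b\<close> are those in \<open>ss\<close> plus one if \<open>b \<in> M\<close>.\<close>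

lemma round_reaches_majority:
  assumes "\<forall>s\<in>set ss. fresh c s"
    and "cnt b ss + (if b \<in> M then 1 else 0) > cnt (\<not> b) ss + (if (\<not> b) \<in> M then 1 else 0)"
  shows "reaches d (ss @ [Inter c ValX M]) (replicate (Suc (length ss)) (Bit b))"
  using assms
proof (induction "cnt b ss + (if b \<in> M then 1 else 0)" arbitrary: ss c M rule: less_induct)
  case less
  define a rs where "a = Inter c ValX M" and "rs = scan d a ss"
  define N where "N = M \<union> {b. cnt b ss > 0}"
  have inter: "\<forall>s\<in>set rs. \<exists>w N. s = Inter c w N"
    and rcnt: "cnt b' rs + (if b' \<notin> M \<and> cnt b' ss > 0 then 1 else 0) = cnt b' ss" for b'
    using scan_round[OF less.prems(1), of d ValX M] by (auto simp: rs_def a_def)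
  \<comment> \<open>The starting cell \<open>a\<close> is included because \<open>rs\<close> may be
    empty, in which case \<open>a\<close> is its own left neighbour.\<close>
  obtain w where last: "last (a # rs) = Inter c w N"
    using scan_round[OF less.prems(1), of d ValX M] by (auto simp: rs_def a_def N_def)
  have len: "length rs = length ss" by (simp add: rs_def)
  have "reaches d (ss @ [a]) (a # rs)"
    using reaches_scan[of "[a]" d ss] by (simp add: rs_def)
  then have r: "reaches d (ss @ [a]) (rs @ [local_rule d (Inter c w N) a])"
    using reaches_step[of d "a # rs"] last
    by (metis reaches_trans queue_step_def list.sel(1,3))
  \<comment> \<open>A strict majority leaves at least one \<open>b\<close>, either in
    \<open>ss\<close> or in \<open>M\<close>. Hence \<open>N\<close> is nonempty and
    \<open>d\<close> is never consulted.\<close>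
  have bN: "b \<in> N"
    using less.prems(2) by (auto simp: N_def split: if_splits)
  show ?case
  proof (cases "(\<not> b) \<in> N")
    case True
    have UN: "N = UNIV"
    proof (rule UNIV_eq_I [symmetric])
      fix b' show "b' \<in> N" using bN True by (cases "b' = b") auto
    qed
    \<comment> \<open>A symbol in \<open>M\<close> was charged to the memory already; any other one
      in \<open>N\<close> loses an occurrence in this round. Either way the loss is exactly
      one.\<close>
    have one: "cnt b' rs + 1 = cnt b' ss + (if b' \<in> M then 1 else 0)" for b'
    proof -
      have "b' \<in> N" using UN by simp
      then show ?thesis using rcnt[of b'] by (auto simp: N_def split: if_splits)
    qed
    have fr: "\<forall>s\<in>set rs. fresh (other c) s"
      using inter by (cases c) (auto simp: fresh_def)
    \<comment> \<open>By \<open>one\<close> both counts drop by one, so the majority persists and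
      the induction measure decreases.\<close>
    have "reaches d (rs @ [Inter (other c) ValX {}]) (replicate (Suc (length rs)) (Bit b))"
      by (rule less.hyps) (use fr one[of b] one[of "\<not> b"] less.prems(2) in auto)
    then show ?thesis
      using reaches_trans[OF r] by (simp add: a_def UN len)
  next
    case False
    have "N = {b}"
    proof (intro set_eqI iffI)
      fix b' assume "b' \<in> N" then show "b' \<in> {b}" using False by (cases "b' = b") auto
    qed (use bN in auto)
    moreover from this False have "N \<noteq> UNIV" by auto
    ultimately have "local_rule d (Inter c w N) a = Bit b" by (simp add: a_def)
    then have "reaches d (ss @ [a]) (rs @ [Bit b])" using r by simp
    moreover have "scan d (Bit b) rs = replicate (length rs) (Bit b)"
      using inter by (intro scan_Bit_Inter) blast
    then have "reaches d (rs @ [Bit b]) (replicate (Suc (length ss)) (Bit b))"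
      using reaches_scan[of "[Bit b]" d rs] by (simp add: len)
    ultimately show ?thesis using reaches_trans by (simp add: a_def)
  qed
qed

lemma split_leading:
  fixes l :: bool
  shows "(\<forall>y\<in>set x. y = l) \<or> (\<exists>i r. x = replicate i l @ (\<not> l) # r)"
proof (induction x)
  case (Cons y x)
  show ?case
  proof (cases "y = l")
    case True
    from Cons.IH show ?thesis
    proof
      assume "\<exists>i r. x = replicate i l @ (\<not> l) # r"
      then obtain i r where "x = replicate i l @ (\<not> l) # r" by blast
      then have "y # x = replicate (Suc i) l @ (\<not> l) # r" using True by simp
      then show ?thesis by blast
    qed (use True in simp)
  next
    case False
    then have "y # x = replicate 0 l @ (\<not> l) # x" by auto
    then show ?thesis by blast
  qed
qed simp

lemma binary_reaches_majority:
  assumes "count_list x b > count_list x (\<not> b)"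
  shows "reaches d (map Bit x) (replicate (length x) (Bit b))"
proof (cases "\<forall>y\<in>set x. y = b")
  case True
  then have "map Bit x = replicate (length x) (Bit b)"
    using replicate_length_same[of "map Bit x" "Bit b"] by simp
  then show ?thesis unfolding reaches_def by (intro exI[of _ 0]) simp
next
  case False
  \<comment> \<open>The left neighbour of the first cell: a leading run of \<open>l\<close> is left
    unchanged, and the first differing cell starts the first round.\<close>
  define l where "l = last x"
  have "b \<in> set x"
    using assms by (cases "b \<in> set x") auto
  then have "\<not> (\<forall>y\<in>set x. y = l)" using False by blast
  then obtain i r where x: "x = replicate i l @ (\<not> l) # r" using split_leading by blast
  have "r \<noteq> []" using x l_def by auto
  then have "last x = last r" unfolding x by simp
  then have lr: "last r = l" by (simp add: l_def)
  let ?p = "map Bit ((\<not> l) # r)"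
  let ?ss = "map Bit (r @ replicate i l)"
  have "reaches d (replicate i (Bit l) @ ?p) (?p @ scan d (last ?p) (replicate i (Bit l)))"
    by (rule reaches_scan) simp
  moreover have "last ?p = Bit l" using \<open>r \<noteq> []\<close> lr by (simp add: last_map)
  ultimately have r1: "reaches d (map Bit x) (Bit (\<not> l) # ?ss)"
    by (simp add: x scan_Bit_replicate)
  have "last (Bit (\<not> l) # ?ss) = Bit l"
    using \<open>r \<noteq> []\<close> lr by (cases "i = 0") (simp_all add: last_map)
  then have "queue_step d (Bit (\<not> l) # ?ss) = ?ss @ [Inter Circ ValX {\<not> l}]"
    unfolding queue_step_def by simp
  then have r2: "reaches d (Bit (\<not> l) # ?ss) (?ss @ [Inter Circ ValX {\<not> l}])"
    by (metis reaches_step)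
  \<comment> \<open>The starting cell lost its bit, but its memory still accounts for it.\<close>
  have cnt: "cnt b' ?ss + (if b' \<in> {\<not> l} then 1 else 0) = count_list x b'" for b'
    unfolding cnt_map_Bit by (auto simp: x)
  have "reaches d (?ss @ [Inter Circ ValX {\<not> l}]) (replicate (Suc (length ?ss)) (Bit b))"
    by (rule round_reaches_majority) (use assms in \<open>auto simp only: cnt, auto simp: fresh_def\<close>)
  moreover have "Suc (length ?ss) = length x" by (simp add: x)
  ultimately show ?thesis using reaches_trans[OF reaches_trans[OF r1 r2]] by (simp only:)
qed

theorem theorem1:
  fixes d :: "symbol \<Rightarrow> symbol \<Rightarrow> symbol" and n :: nat and x :: "bool list" and b :: bool
  assumes "\<forall>a\<in>Sigma_alph. \<forall>y\<in>Sigma_alph. d a y \<in> Sigma_alph"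
    and "n \<ge> 1" and "length x = n"
    and "count_list x False \<noteq> count_list x True"
    and "count_list x b > count_list x (\<not> b)"
  shows "(\<exists>K. \<forall>k\<ge>K. (seq_update d ^^ k) (map Bit x) = replicate n (Bit b)) \<and>
    seq_update d (replicate n (Bit b)) = replicate n (Bit b)"
proof
  obtain m where m: "(queue_step d ^^ m) (map Bit x) = replicate n (Bit b)"
    using binary_reaches_majority[OF assms(5)] assms(3) unfolding reaches_def by metis
  have "(seq_update d ^^ k) (map Bit x) = replicate n (Bit b)" if "k \<ge> m" for k
  proof -
    \<comment> \<open>Each application makes \<open>n\<close> queue steps, so \<open>k\<close> of
      them suffice; the surplus steps fix the constant configuration.\<close>
    have "m \<le> k * n" using that assms(2) by (metis le_trans mult_le_mono2 nat_mult_1_right)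
    then have "k * n = (k * n - m) + m" by simp
    then have "(queue_step d ^^ (k * n)) (map Bit x)
        = (queue_step d ^^ (k * n - m)) ((queue_step d ^^ m) (map Bit x))"
      by (metis comp_apply funpow_add)
    then show ?thesis using m assms(2,3) by (simp add: seq_update_funpow_conv_queue)
  qed
  then show "\<exists>K. \<forall>k\<ge>K. (seq_update d ^^ k) (map Bit x) = replicate n (Bit b)" by blast
  show "seq_update d (replicate n (Bit b)) = replicate n (Bit b)"
    using assms(2) by (simp add: seq_update_conv_queue)
qed

end
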